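(* Gelfand-MacPherson's web $\boldsymbol{\mathcal W}^{GM}_{\mathbb S_5}$ on the spinor tenfold $\mathbb S_5$ is cluster with respect to Ducat's generalized cluster (Laurent phenomenon algebra) structure of finite type on $\mathbb S_5$; that is, its ten first integrals (the face maps $\Pi_F:\mathbb S_5\dashrightarrow\mathbb S_{4,F}$) have components which, written in the initial cluster variables at the source and in some Wick coordinates at the target, are cluster variables, possibly up to sign and up to multiplication by a monomial in the frozen variables.
   Context: **Spinor tenfold and Wick coordinates.** For $X=(x_{ij})\in\mathrm{Asym}_5(\mathbf C)$ let $\mathrm{Pf}(X_{\hat k})$ be the Pfaffian of the $4\times4$ matrix obtained by deleting line and column $k$. $\mathbb S_5\subset\mathbf P^{15}$ is the closure of the image of $W:X\mapsto[1:(x_{ij})_{i<j}:(\mathrm{Pf}(X_{\hat k}))_{k=1}^5]$. The 16 coordinates are the weight coordinates of the half-spin representation; the weights are the vectors of $\{\pm\frac12\}^5$ with an even number of minus signs: $1$ has weight $(\frac12,\dots,\frac12)$, $x_{ij}$ has minus signs exactly at $i,j$, $\mathrm{Pf}(X_{\hat k})$ has its only plus sign at $k$. **Face maps and web.** The ten relevant facets $F$ of the weight polytope (convex hull of the weights) are those given by fixing the $i$-th entry equal to $+\frac12$ or to $-\frac12$ ($i=1,\dots,5$). $\Pi_F$ is the linear projection of $\mathbb S_5$ onto the 8 weight coordinates of the vertices of $F$; its image $\mathbb S_{4,F}\subset\mathbf P^7$ is a smooth 6-dimensional quadric (a spinor sixfold), parametrized, after normalizing one of the 8 coordinates to 1,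 by $\mathrm{Asym}_4(\mathbf C)\ni M\mapsto[1:M:\mathrm{Pf}(M)]$ (up to signs of the coordinates); the six entries of $M$ are Wick coordinates on the target. $\boldsymbol{\mathcal W}^{GM}_{\mathbb S_5}$ is the web with the ten first integrals $\Pi_F$. **Ducat's LPA.** It is a Laurent phenomenon algebra (in the sense of Lam–Pylyavskyy) on the homogeneous coordinate ring of (an open subset of the affine cone over) $\mathbb S_5$, with initial cluster variables $x_1,x_2,x_3$, exchange polynomials $F_1=a_5x_2+a_8x_3+a_2a_3$, $F_2=a_6x_1x_3+a_3a_4x_1+a_8a_1x_3+a_1a_2a_3$, $F_3=a_4x_1+a_7x_2+a_1a_2$, and frozen variables $a_1,\dots,a_8$. Its other (non-initial) cluster variables are $X_1=\frac{F_1}{x_1}$, $X_2=\frac{F_2}{x_2}$, $X_3=\frac{F_3}{x_3}$, $X_{12}=\frac{a_1a_2a_3+a_1a_5x_2+a_1a_8x_3+a_3a_4x_1+a_6x_1x_3}{x_1x_2}$, $X_{23}=\frac{a_1a_2a_3+a_1a_8x_3+a_3a_4x_1+a_3a_7x_2+a_6x_1x_3}{x_2x_3}$, $X_{13}=\frac{N}{x_1x_3}$, $X_{123}=\frac{N+a_2a_6x_1x_3}{x_1x_2x_3}$, with $N=a_1a_2^2a_3+a_1a_2a_5x_2+a_1a_2a_8x_3+a_2a_3a_4x_1+a_2a_3a_7x_2+a_4a_5x_1x_2+a_5a_7x_2^2+a_7a_8x_2x_3$. The initial variables are, up to non-zero constant rescalings, the restrictions to the affine cone over $\mathbb S_5$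 of the following weight coordinates: $a_5\leftrightarrow 1$, $x_1\leftrightarrow x_{14}$, $x_2\leftrightarrow\mathrm{Pf}(X_{\hat2})$, $x_3\leftrightarrow x_{13}$, $a_1\leftrightarrow\mathrm{Pf}(X_{\hat5})$, $a_2\leftrightarrow x_{15}$, $a_3\leftrightarrow x_{34}$, $a_4\leftrightarrow\mathrm{Pf}(X_{\hat4})$, $a_6\leftrightarrow\mathrm{Pf}(X_{\hat1})$, $a_7\leftrightarrow x_{12}$, $a_8\leftrightarrow x_{45}$ (the coordinates $x_{14}$ etc. on the right refer to the Wick chart). "Cluster variables" includes the frozen ones; "monomial" means Laurent monomial. *)

theory Defs
  imports "HOL-Analysis.Analysis"
begin

(* A skew-symmetric n x n matrix is a function on index pairs; only its entries with
   indices in {1..n} matter. *)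
definition Asym :: "nat \<Rightarrow> (nat \<Rightarrow> nat \<Rightarrow> complex) set" where
  "Asym n = {X. \<forall>i\<in>{1..n}. \<forall>j\<in>{1..n}. X j i = - X i j}"

(* Pfaffian of the submatrix of X whose rows and columns are listed (in increasing order),
   by expansion along its first row. *)
function pfaffian :: "(nat \<Rightarrow> nat \<Rightarrow> complex) \<Rightarrow> nat list \<Rightarrow> complex" where
  "pfaffian X [] = 1"
| "pfaffian X (i # js) =
     (\<Sum>k<length js. (-1) ^ k * X i (js ! k) * pfaffian X (take k js @ drop (Suc k) js))"
  by pat_completeness auto
termination by (relation "Wellfounded.measure (\<lambda>(X, l). length l)") auto

(* A weight of the half-spin representation is encoded by the set S of positions of its
   minus signs; weight_vector S is the weight itself. *)
definition weights :: "nat \<Rightarrow> nat set set" where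
  "weights n = {S. S \<subseteq> {1..n} \<and> even (card S)}"

definition weight_vector :: "nat set \<Rightarrow> nat \<Rightarrow> real" where
  "weight_vector S i = (if i \<in> S then - (1/2) else 1/2)"

(* For n = 5 this is the Wick parametrization W: the coordinates of weights {}, {i, j} and
   {1..5} - {k} are 1, x_ij and the Pfaffian of X with line and column k deleted.
   For n = 4 it is [1 : M : Pf M].
   Points of the coordinate space are functions vanishing off the set of weights. *)
definition wick :: "nat \<Rightarrow> (nat \<Rightarrow> nat \<Rightarrow> complex) \<Rightarrow> nat set \<Rightarrow> complex" where
  "wick n X S = (if S \<in> weights n then pfaffian X (sorted_list_of_set S) else 0)"

(* Affine cone over the closure of the image of the projective map given by wick n.  For the
   image of a polynomial map, Euclidean and Zariski closure coincide.  Points of the spinor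
   tenfold are the nonzero vectors of spinor_cone 5 up to scaling. *)
definition spinor_cone :: "nat \<Rightarrow> (nat set \<Rightarrow> complex) set" where
  "spinor_cone n = closure {\<lambda>S. t * wick n X S | t X. X \<in> Asym n}"

definition facet :: "nat \<Rightarrow> real \<Rightarrow> nat set set" where
  "facet i s = {S \<in> weights 5. weight_vector S i = s}"

definition gm_facets :: "nat set set set" where
  "gm_facets = {facet i s | i s. i \<in> {1..5} \<and> s \<in> {1/2, - (1/2)}}"

(* The projection Pi_F in homogeneous coordinates. *)
definition face_map :: "nat set set \<Rightarrow> (nat set \<Rightarrow> complex) \<Rightarrow> nat set \<Rightarrow> complex" where
  "face_map F p = (\<lambda>S. if S \<in> F then p S else 0)"

(* The labelling \<beta> of the eight vertices of F by the weights of the sixfold, together with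
   the signs \<epsilon>, makes the part of the image of Pi_F on which the coordinate \<beta> {} equals 1
   the set of all [1 : M : Pf M], up to the signs \<epsilon>. *)
definition wick_chart :: "nat set set \<Rightarrow> (nat set \<Rightarrow> nat set) \<Rightarrow> (nat set \<Rightarrow> complex) \<Rightarrow> bool" where
  "wick_chart F \<beta> \<epsilon> \<longleftrightarrow>
     bij_betw \<beta> (weights 4) F \<and>
     (\<forall>T\<in>weights 4. \<epsilon> T \<in> {1, -1}) \<and>
     (\<forall>q. (\<forall>S. S \<notin> F \<longrightarrow> q S = 0) \<and> q (\<beta> {}) = 1 \<longrightarrow>
        (q \<in> face_map F ` spinor_cone 5 \<longleftrightarrow>
         (\<exists>M\<in>Asym 4. \<forall>T\<in>weights 4. q (\<beta> T) = \<epsilon> T * wick 4 M T)))"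

(* The entry M i j of the point with homogeneous coordinates q. *)
definition wick_coordinate ::
    "(nat set \<Rightarrow> nat set) \<Rightarrow> (nat set \<Rightarrow> complex) \<Rightarrow> nat \<Rightarrow> nat \<Rightarrow> (nat set \<Rightarrow> complex) \<Rightarrow> complex" where
  "wick_coordinate \<beta> \<epsilon> i j q = \<epsilon> {i, j} * q (\<beta> {i, j}) / q (\<beta> {})"

datatype ducat_var = x_1 | x_2 | x_3 | a_1 | a_2 | a_3 | a_4 | a_5 | a_6 | a_7 | a_8

definition frozen :: "ducat_var set" where
  "frozen = {a_1, a_2, a_3, a_4, a_5, a_6, a_7, a_8}"

(* Laurent polynomials in the initial variables are represented by the functions they induce
   on value assignments y; they are only evaluated where all initial variables are nonzero. *)
type_synonym laurent = "(ducat_var \<Rightarrow> complex) \<Rightarrow> complex"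

definition exchange_1 :: laurent where
  "exchange_1 y = y a_5 * y x_2 + y a_8 * y x_3 + y a_2 * y a_3"

definition exchange_2 :: laurent where
  "exchange_2 y = y a_6 * y x_1 * y x_3 + y a_3 * y a_4 * y x_1
     + y a_8 * y a_1 * y x_3 + y a_1 * y a_2 * y a_3"

definition exchange_3 :: laurent where
  "exchange_3 y = y a_4 * y x_1 + y a_7 * y x_2 + y a_1 * y a_2"

definition cluster_X1 :: laurent where "cluster_X1 y = exchange_1 y / y x_1"
definition cluster_X2 :: laurent where "cluster_X2 y = exchange_2 y / y x_2"
definition cluster_X3 :: laurent where "cluster_X3 y = exchange_3 y / y x_3"

definition cluster_X12 :: laurent where
  "cluster_X12 y =
     (y a_1 * y a_2 * y a_3 + y a_1 * y a_5 * y x_2 + y a_1 * y a_8 * y x_3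
      + y a_3 * y a_4 * y x_1 + y a_6 * y x_1 * y x_3) / (y x_1 * y x_2)"

definition cluster_X23 :: laurent where
  "cluster_X23 y =
     (y a_1 * y a_2 * y a_3 + y a_1 * y a_8 * y x_3 + y a_3 * y a_4 * y x_1
      + y a_3 * y a_7 * y x_2 + y a_6 * y x_1 * y x_3) / (y x_2 * y x_3)"

definition ducat_N :: laurent where
  "ducat_N y =
     y a_1 * (y a_2)^2 * y a_3 + y a_1 * y a_2 * y a_5 * y x_2 + y a_1 * y a_2 * y a_8 * y x_3
     + y a_2 * y a_3 * y a_4 * y x_1 + y a_2 * y a_3 * y a_7 * y x_2
     + y a_4 * y a_5 * y x_1 * y x_2 + y a_5 * y a_7 * (y x_2)^2
     + y a_7 * y a_8 * y x_2 * y x_3"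

definition cluster_X13 :: laurent where
  "cluster_X13 y = ducat_N y / (y x_1 * y x_3)"

definition cluster_X123 :: laurent where
  "cluster_X123 y =
     (ducat_N y + y a_2 * y a_6 * y x_1 * y x_3) / (y x_1 * y x_2 * y x_3)"

definition cluster_variables :: "laurent set" where
  "cluster_variables = range (\<lambda>v y. y v) \<union>
     {cluster_X1, cluster_X2, cluster_X3, cluster_X12, cluster_X23, cluster_X13, cluster_X123}"

definition frozen_monomial :: "(ducat_var \<Rightarrow> int) \<Rightarrow> laurent" where
  "frozen_monomial e y = (\<Prod>v\<in>frozen. y v powi e v)"

fun initial_weight :: "ducat_var \<Rightarrow> nat set" where
  "initial_weight x_1 = {1, 4}"
| "initial_weight x_2 = {1..5} - {2}"
| "initial_weight x_3 = {1, 3}"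
| "initial_weight a_1 = {1..5} - {5}"
| "initial_weight a_2 = {1, 5}"
| "initial_weight a_3 = {3, 4}"
| "initial_weight a_4 = {1..5} - {4}"
| "initial_weight a_5 = {}"
| "initial_weight a_6 = {1..5} - {1}"
| "initial_weight a_7 = {1, 2}"
| "initial_weight a_8 = {4, 5}"

(* c holds the constants by which the weight coordinates are rescaled. *)
definition initial_values ::
    "(ducat_var \<Rightarrow> complex) \<Rightarrow> (nat set \<Rightarrow> complex) \<Rightarrow> ducat_var \<Rightarrow> complex" where
  "initial_values c p = (\<lambda>v. c v * p (initial_weight v))"

definition initial_torus :: "(nat set \<Rightarrow> complex) set" where
  "initial_torus = {p \<in> spinor_cone 5. \<forall>v. p (initial_weight v) \<noteq> 0}"

inductive_set algebra_generated :: "('a \<Rightarrow> complex) set \<Rightarrow> ('a \<Rightarrow> complex) set"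
  for G :: "('a \<Rightarrow> complex) set" where
  const: "(\<lambda>p. z) \<in> algebra_generated G"
| gen: "g \<in> G \<Longrightarrow> g \<in> algebra_generated G"
| add: "f \<in> algebra_generated G \<Longrightarrow> g \<in> algebra_generated G \<Longrightarrow> (\<lambda>p. f p + g p) \<in> algebra_generated G"
| mult: "f \<in> algebra_generated G \<Longrightarrow> g \<in> algebra_generated G \<Longrightarrow> (\<lambda>p. f p * g p) \<in> algebra_generated G"

(* With the rescalings c, Ducat's algebra is a structure on the homogeneous coordinate ring:
   the initial variables are coordinates on a torus in the affine cone, and the algebra
   generated by all cluster variables and the inverses of the frozen ones is the coordinate
   ring of the open subset of the cone where the frozen variables do not vanish.  The cone
   is irreducible, so both algebras may be compared as algebras of functions on the torus. *)
definition ducat_structure :: "(ducat_var \<Rightarrow> complex) \<Rightarrow> bool" where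
  "ducat_structure c \<longleftrightarrow>
     (\<forall>v. c v \<noteq> 0) \<and>
     bij_betw (initial_values c) initial_torus {y. \<forall>v. y v \<noteq> 0} \<and>
     (\<lambda>f. restrict f initial_torus) ` algebra_generated
        ((\<lambda>Z p. Z (initial_values c p)) ` cluster_variables
         \<union> (\<lambda>v p. inverse (initial_values c p v)) ` frozen) =
     (\<lambda>f. restrict f initial_torus) ` algebra_generated
        ((\<lambda>S p. p S) ` weights 5
         \<union> (\<lambda>v p. inverse (p (initial_weight v))) ` frozen)"

end

theory Submission
  imports Defs
begin

text \<open>Any Wick coordinate of a face map is, up to sign, a quotient of two weight coordinates of the
  tenfold, and the denominator is the coordinate at the vertex at which the chart is centred. So it
  suffices to show that all 16 weight coordinates are cluster variables up to sign, and that each of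
  the ten facets has a chart centred at the weight of a frozen variable.

  The first fact (\<open>weight_coordinate_is_cluster_variable\<close>) rests on the ten quadrics that vanish on
  the tenfold, one for each facet. After changing the signs of two frozen coordinates, the exchange relations of \<open>X\<^sub>1\<close> and \<open>X\<^sub>3\<close> are two of them, and Ducat's formulas
  for \<open>X\<^sub>1\<^sub>2, X\<^sub>2\<^sub>3, X\<^sub>1\<^sub>2\<^sub>3\<close> are combinations of these two with three others. This identifies the
  five non-initial weight coordinates with \<open>X\<^sub>1, X\<^sub>3, X\<^sub>1\<^sub>2, X\<^sub>2\<^sub>3, X\<^sub>1\<^sub>2\<^sub>3\<close>. The variables
  \<open>X\<^sub>2\<close> and \<open>X\<^sub>1\<^sub>3\<close> turn out to be quadratic in the weight coordinates. This gives
  \<open>ducat_structure_ducat_sign\<close>: the initial variables are coordinates on the torus, and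
  the cluster variables and the weight coordinates generate the same algebra.

  For the second fact (\<open>gm_facet_has_chart\<close>), a facet that fixes a plus sign contains the
  weight of \<open>a\<^sub>5\<close>, and one that fixes the minus sign at \<open>i\<close> contains some \<open>{i, j}\<close> whose coordinate
  \<open>x\<^sub>i\<^sub>j\<close> is frozen, namely one of \<open>a\<^sub>3, a\<^sub>7, a\<^sub>8\<close>. The image of the face map lies on the quadric of
  the facet. Conversely, each point of that quadric at which the chosen coordinate is 1 is the
  projection of an explicit point \<open>W(X)\<close> of the tenfold, which gives the points of the chart without
  passing to a limit.\<close>

section \<open>Weights and the Wick parametrization\<close>

lemma pfaffian_quadruple:
  "pfaffian X [a, b, c, d] = X a b * X c d - X a c * X b d + X a d * X b c"
  by (simp add: eval_nat_numeral)

lemma wick_empty: "wick n X {} = 1"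
  by (simp add: wick_def weights_def)

lemma wick_pair:
  assumes "a < b" "{a, b} \<subseteq> {1..n}"
  shows "wick n X {a, b} = X a b"
proof -
  have "sorted_list_of_set {a, b} = [a, b]"
    using assms(1) by simp
  then show ?thesis
    using assms by (simp add: wick_def weights_def)
qed

lemma wick_quadruple:
  assumes "a < b" "b < c" "c < d" "{a, b, c, d} \<subseteq> {1..n}"
  shows "wick n X {a, b, c, d} = X a b * X c d - X a c * X b d + X a d * X b c"
proof -
  have "sorted_list_of_set {a, b, c, d} = [a, b, c, d]"
    using assms(1-3) by simp
  then show ?thesis
    using assms by (simp add: wick_def weights_def pfaffian_quadruple del: pfaffian.simps)
qed

text \<open>Filtering one element at a time turns the list of all subsets into the list of the even
  ones; the result is written as a union because a case distinction whose branches
  both contain the remaining set would grow exponentially.\<close>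
lemma filter_insert:
  "{x \<in> insert a A. P x} =
     (if P a then {a} else {}) \<union> {x \<in> A. P x}"
  by auto

lemma weights_4:
  "weights 4 = {{}, {1, 2}, {1, 3}, {1, 4}, {2, 3}, {2, 4}, {3, 4}, {1, 2, 3, 4}}"
proof -
  have "{1..4::nat} = {1, 2, 3, 4}" by auto
  then have "weights 4 = {S \<in> Pow {1, 2, 3, 4}. even (card S)}"
    by (auto simp: weights_def)
  also have "\<dots> = {{}, {1, 2}, {1, 3}, {1, 4}, {2, 3}, {2, 4}, {3, 4}, {1, 2, 3, 4}}"
    unfolding Pow_insert Pow_empty image_Un image_insert image_empty Un_insert_left Un_empty_left
      filter_insert
    by (simp add: insert_commute del: One_nat_def)
  finally show ?thesis .
qed

lemma weights_5:
  "weights 5 = {{}, {1, 2}, {1, 3}, {1, 4}, {1, 5}, {2, 3}, {2, 4}, {2, 5}, {3, 4}, {3, 5}, {4, 5},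
     {1, 2, 3, 4}, {1, 2, 3, 5}, {1, 2, 4, 5}, {1, 3, 4, 5}, {2, 3, 4, 5}}"
proof -
  have "{1..5::nat} = {1, 2, 3, 4, 5}" by auto
  then have "weights 5 = {S \<in> Pow {1, 2, 3, 4, 5}. even (card S)}"
    by (auto simp: weights_def)
  also have "\<dots> = {{}, {1, 2}, {1, 3}, {1, 4}, {1, 5}, {2, 3}, {2, 4}, {2, 5}, {3, 4}, {3, 5},
     {4, 5}, {1, 2, 3, 4}, {1, 2, 3, 5}, {1, 2, 4, 5}, {1, 3, 4, 5}, {2, 3, 4, 5}}"
    unfolding Pow_insert Pow_empty image_Un image_insert image_empty Un_insert_left Un_empty_left
      filter_insert
    by (simp add: insert_commute del: One_nat_def)
  finally show ?thesis .
qed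

lemma initial_weight_quadruples:
  "initial_weight x_2 = {1, 3, 4, 5}" "initial_weight a_1 = {1, 2, 3, 4}"
  "initial_weight a_4 = {1, 2, 3, 5}" "initial_weight a_6 = {2, 3, 4, 5}"
proof -
  have "{1..5::nat} = {1, 2, 3, 4, 5}" by auto
  then show "initial_weight x_2 = {1, 3, 4, 5}" "initial_weight a_1 = {1, 2, 3, 4}"
    "initial_weight a_4 = {1, 2, 3, 5}" "initial_weight a_6 = {2, 3, 4, 5}"
    by auto
qed

lemmas initial_weight_sets = initial_weight.simps(1,3,5,6,8,10,11) initial_weight_quadruples

text \<open>The skew-symmetric matrix with prescribed entries above the diagonal. The entries are
  indexed by unordered pairs, so that coordinates of a point indexed by weights can be used as
  they are.\<close>
definition skew_of :: "(nat set \<Rightarrow> complex) \<Rightarrow> nat \<Rightarrow> nat \<Rightarrow> complex" where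
  "skew_of u i j = (if i < j then u {i, j} else if j < i then - u {i, j} else 0)"

lemma skew_of_Asym: "skew_of u \<in> Asym n"
  by (auto simp: skew_of_def Asym_def insert_commute)

section \<open>Labelling the vertices of a facet by the weights of the sixfold\<close>

text \<open>The facets considered here fix the position \<open>L ! 0\<close>. The list \<open>L\<close> identifies \<open>{1..4}\<close> with
  the other four positions, and \<open>B\<close> is the vertex at which the chart is centred: the label \<open>T\<close>
  says at which positions the signs of a vertex differ from those of \<open>B\<close>. As the positions in
  \<open>L\<close> are counted from zero, the entries of \<open>T\<close> never point to the fixed position.\<close>
definition face_label :: "nat list \<Rightarrow> nat set \<Rightarrow> nat set \<Rightarrow> nat set" where
  "face_label L B T = sym_diff B ((!) L ` T)"

lemma even_card_sym_diff:
  assumes "finite A" "finite B"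
  shows "even (card (sym_diff A B)) \<longleftrightarrow> (even (card A) \<longleftrightarrow> even (card B))"
proof -
  have "card (sym_diff A B) = card (A - B) + card (B - A)"
    using assms by (intro card_Un_disjoint) auto
  moreover have "card A = card (A - B) + card (A \<inter> B)" "card B = card (B - A) + card (A \<inter> B)"
    using card_Int_Diff[OF assms(1), of B] card_Int_Diff[OF assms(2), of A]
    by (simp_all add: Int_commute)
  ultimately show ?thesis
    by (simp only: even_add) argo
qed

text \<open>Flipping the signs at the positions in \<open>B\<close> is an involution that preserves the parity of
  the number of minus signs. So the label of a vertex \<open>S\<close> is recovered as the set of places in \<open>L\<close>
  where \<open>S\<close> differs from \<open>B\<close>.\<close>
lemma face_label_bij:
  assumes "distinct L" "length L = 5" "set L = {1..5}" "B \<in> weights 5"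
  shows "bij_betw (face_label L B) (weights 4) {S \<in> weights 5. L ! 0 \<in> S \<longleftrightarrow> L ! 0 \<in> B}"
    (is "bij_betw _ _ ?F")
proof -
  have inj: "inj_on ((!) L) {..4}"
    using assms(1,2) by (auto simp: inj_on_def nth_eq_iff_index_eq)
  have img: "(!) L ` {..4} = {1..5}"
  proof -
    have "(!) L ` {..4} = set L"
      using assms(2) by (auto simp: set_conv_nth image_def less_Suc_eq_le eval_nat_numeral)
    then show ?thesis using assms(3) by simp
  qed
  have sub: "T \<subseteq> {..4}" "0 \<notin> T" if "T \<in> weights 4" for T
    using that by (auto simp: weights_def)
  have B: "B \<subseteq> {1..5}" "even (card B)" "finite B"
    using assms(4) by (auto simp: weights_def intro: finite_subset)
  show ?thesis
  proof (rule bij_betw_imageI)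
    show "inj_on (face_label L B) (weights 4)"
    proof (rule inj_onI)
      fix T T' assume T: "T \<in> weights 4" "T' \<in> weights 4" "face_label L B T = face_label L B T'"
      then have "(!) L ` T = (!) L ` T'"
        unfolding face_label_def by blast
      then show "T = T'"
        using inj_on_image_eq_iff[OF inj] sub T by metis
    qed
    show "face_label L B ` weights 4 = ?F"
    proof (intro equalityI subsetI)
      fix S assume "S \<in> face_label L B ` weights 4"
      then obtain T where T: "T \<in> weights 4" and S: "S = sym_diff B ((!) L ` T)"
        by (auto simp: face_label_def)
      have "(!) L ` T \<subseteq> {1..5}" using sub[OF T] img by blast
      moreover have "finite T" "even (card T)"
        using T by (auto simp: weights_def intro: finite_subset)
      moreover have "card ((!) L ` T) = card T"
        using inj sub[OF T] by (meson card_image inj_on_subset)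
      moreover have "L ! 0 \<notin> (!) L ` T"
        using inj_on_image_mem_iff[OF inj, of 0 T] sub[OF T] by simp
      ultimately show "S \<in> ?F"
        using B even_card_sym_diff[of B "(!) L ` T"] unfolding S weights_def by auto
    next
      fix S assume S: "S \<in> ?F"
      define U where "U = sym_diff B S"
      define T where "T = {a \<in> {..4}. L ! a \<in> U}"
      have S': "S \<subseteq> {1..5}" "even (card S)" "finite S"
        using S by (auto simp: weights_def intro: finite_subset)
      have "U \<subseteq> {1..5}" "even (card U)" "L ! 0 \<notin> U"
        using S S' B even_card_sym_diff[of B S] by (auto simp: U_def)
      moreover have TU: "(!) L ` T = U"
      proof -
        have "U \<subseteq> (!) L ` {..4}" using \<open>U \<subseteq> {1..5}\<close> img by simp
        then show ?thesis unfolding T_def by auto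
      qed
      moreover have "card ((!) L ` T) = card T"
        using inj by (rule card_image[OF inj_on_subset]) (auto simp: T_def)
      moreover have "T \<subseteq> {1..4}"
      proof
        fix a assume "a \<in> T"
        then have "a \<le> 4" "a \<noteq> 0" using \<open>L ! 0 \<notin> U\<close> by (auto simp: T_def intro!: gr0I)
        then show "a \<in> {1..4}" by simp
      qed
      ultimately have "T \<in> weights 4"
        by (simp add: weights_def)
      moreover have "S = face_label L B T"
        unfolding face_label_def TU U_def by blast
      ultimately show "S \<in> face_label L B ` weights 4" by blast
    qed
  qed
qed

section \<open>Quadrics and charts\<close>

text \<open>The equation \<open>Pf M = M\<^sub>1\<^sub>2 M\<^sub>3\<^sub>4 - M\<^sub>1\<^sub>3 M\<^sub>2\<^sub>4 + M\<^sub>1\<^sub>4 M\<^sub>2\<^sub>3\<close> of the spinor sixfold, made homogeneous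
  by the coordinate at \<open>\<beta> {}\<close>.\<close>
definition chart_quadric :: "(nat set \<Rightarrow> nat set) \<Rightarrow> (nat set \<Rightarrow> complex) \<Rightarrow> bool" where
  "chart_quadric \<beta> q \<longleftrightarrow>
     q (\<beta> {}) * q (\<beta> {1, 2, 3, 4}) =
     q (\<beta> {1, 2}) * q (\<beta> {3, 4}) - q (\<beta> {1, 3}) * q (\<beta> {2, 4}) + q (\<beta> {1, 4}) * q (\<beta> {2, 3})"

lemma spinor_cone_subset_closed:
  assumes "closed C" "\<And>t X. X \<in> Asym n \<Longrightarrow> (\<lambda>S. t * wick n X S) \<in> C"
  shows "spinor_cone n \<subseteq> C"
  unfolding spinor_cone_def using assms by (intro closure_minimal) auto

lemma wick_in_cone: "X \<in> Asym n \<Longrightarrow> (\<lambda>S. t * wick n X S) \<in> spinor_cone n"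
  unfolding spinor_cone_def by (rule subsetD[OF closure_subset]) blast

lemma spinor_cone_supported:
  assumes "p \<in> spinor_cone n" "S \<notin> weights n"
  shows "p S = 0"
proof -
  have "spinor_cone n \<subseteq> {p. p S = 0}"
    by (rule spinor_cone_subset_closed)
       (auto intro!: closed_Collect_eq continuous_on_component continuous_intros simp: wick_def assms(2))
  then show ?thesis using assms(1) by auto
qed

text \<open>A quadratic identity between the Wick polynomials passes to the closure because its zero set
  is closed.\<close>
lemma spinor_cone_quadric:
  assumes "\<And>t X. chart_quadric \<beta> (\<lambda>S. t * wick n X S)" "p \<in> spinor_cone n"
  shows "chart_quadric \<beta> p"
proof -
  have "closed {p. chart_quadric \<beta> p}"
    unfolding chart_quadric_def
    by (intro closed_Collect_eq continuous_intros continuous_on_product_coordinates)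
  then have "spinor_cone n \<subseteq> {p. chart_quadric \<beta> p}"
    using assms(1) by (intro spinor_cone_subset_closed) auto
  then show ?thesis using assms(2) by auto
qed

text \<open>Where the coordinate at \<open>\<beta> {}\<close> is 1, the quadric is the graph of the Pfaffian over the six
  coordinates at \<open>\<beta> {i, j}\<close>. So a chart needs no more than that the image of the cone satisfies
  the quadric and contains all its points with this coordinate equal to 1.\<close>
lemma wick_chartI:
  assumes bij: "bij_betw \<beta> (weights 4) F"
    and quadric: "\<And>p. p \<in> spinor_cone 5 \<Longrightarrow> chart_quadric \<beta> p"
    and lift: "\<And>q. q (\<beta> {}) = 1 \<Longrightarrow> chart_quadric \<beta> q \<Longrightarrow>
                 \<exists>p\<in>spinor_cone 5. \<forall>S\<in>F. p S = q S"
  shows "wick_chart F \<beta> (\<lambda>_. 1)"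
proof -
  have mem: "\<beta> T \<in> F" if "T \<in> weights 4" for T
    using bij that by (auto dest: bij_betw_apply)
  have chart: "q \<in> face_map F ` spinor_cone 5 \<longleftrightarrow> (\<exists>M\<in>Asym 4. \<forall>T\<in>weights 4. q (\<beta> T) = wick 4 M T)"
    if off: "\<forall>S. S \<notin> F \<longrightarrow> q S = 0" and one: "q (\<beta> {}) = 1" for q
  proof
    assume "q \<in> face_map F ` spinor_cone 5"
    then obtain p where p: "p \<in> spinor_cone 5" "q = face_map F p" by blast
    have "chart_quadric \<beta> q"
      using quadric[OF p(1)] mem unfolding p(2) chart_quadric_def face_map_def
      by (simp add: weights_4 del: One_nat_def)
    then have "\<forall>T\<in>weights 4. q (\<beta> T) = wick 4 (skew_of (\<lambda>T. q (\<beta> T))) T"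
      using one by (simp add: weights_4 wick_empty wick_pair wick_quadruple skew_of_def chart_quadric_def
                         del: One_nat_def)
    then show "\<exists>M\<in>Asym 4. \<forall>T\<in>weights 4. q (\<beta> T) = wick 4 M T"
      using skew_of_Asym by blast
  next
    assume "\<exists>M\<in>Asym 4. \<forall>T\<in>weights 4. q (\<beta> T) = wick 4 M T"
    then obtain M where "\<forall>T\<in>weights 4. q (\<beta> T) = wick 4 M T" by blast
    then have "chart_quadric \<beta> q"
      by (simp add: weights_4 wick_empty wick_pair wick_quadruple chart_quadric_def del: One_nat_def)
    then obtain p where "p \<in> spinor_cone 5" "\<forall>S\<in>F. p S = q S"
      using lift one by blast
    moreover from this have "q = face_map F p"
      using off by (auto simp: face_map_def)
    ultimately show "q \<in> face_map F ` spinor_cone 5" by blast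
  qed
  then show ?thesis
    unfolding wick_chart_def using bij by auto
qed

text \<open>The first five charts belong to the facets that fix a plus sign and are centred at the weight
  of the coordinate 1. The last five belong to the facets that fix the minus sign at \<open>i = L ! 0\<close>;
  they are centred at \<open>{i, j}\<close> with \<open>j = L ! 1\<close>. Three requirements are met by the choice of \<open>j\<close> and
  of the order of \<open>L\<close>: the coordinate at \<open>{i, j}\<close> is frozen; \<open>i\<close> and \<open>j\<close> are adjacent, so that the
  product of the entries above the diagonal at \<open>{i, j}\<close> and \<open>{k, l}\<close> has coefficient \<open>+1\<close> in the
  Pfaffian of the lines \<open>i, j, k, l\<close>; and the relation \<open>\<Sum>\<^sub>j (-1)\<^sup>j x\<^sub>i\<^sub>j Pf(X\<^sub>j) = 0\<close>, where \<open>X\<^sub>j\<close>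
  is \<open>X\<close> without line and column \<open>j\<close>, takes the form of the quadric without further signs.\<close>
definition face_charts :: "(nat list \<times> nat set) list" where
  "face_charts =
     [([1, 2, 3, 4, 5], {}), ([2, 1, 3, 4, 5], {}), ([3, 1, 2, 4, 5], {}),
      ([4, 1, 2, 3, 5], {}), ([5, 1, 2, 3, 4], {}),
      ([1, 2, 3, 4, 5], {1, 2}), ([2, 1, 3, 4, 5], {1, 2}), ([3, 4, 2, 1, 5], {3, 4}),
      ([4, 5, 1, 2, 3], {4, 5}), ([5, 4, 1, 2, 3], {4, 5})]"

text \<open>For a plus facet the quadric is the expansion of a Pfaffian of size 4; for a minus facet it
  is the expansion of a Pfaffian of size 6 with two equal lines, which vanishes.\<close>
lemma face_charts_quadric:
  assumes "(L, B) \<in> set face_charts" "p \<in> spinor_cone 5"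
  shows "chart_quadric (face_label L B) p"
proof (rule spinor_cone_quadric[OF _ assms(2)])
  fix t X
  have "\<forall>(L, B)\<in>set face_charts. chart_quadric (face_label L B) (\<lambda>S. t * wick 5 X S)"
    by (simp add: face_charts_def chart_quadric_def face_label_def insert_Diff_if insert_commute
          wick_empty wick_pair wick_quadruple del: One_nat_def)
       (simp add: algebra_simps)
  then show "chart_quadric (face_label L B) (\<lambda>S. t * wick 5 X S)"
    using assms(1) by blast
qed

text \<open>The matrix \<open>X\<close> is read off from \<open>q\<close>. For a plus facet \<open>q\<close> lists its entries away from line
  \<open>i\<close>, and line \<open>i\<close> can be zero. For a minus facet \<open>q\<close> gives the entries in
  line \<open>i\<close>, among them 1 at \<open>{i, j}\<close>. With the rest of line \<open>j\<close> set to zero, the Pfaffian of the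
  lines \<open>i, j, k, l\<close> is just the entry above the diagonal at \<open>{k, l}\<close>, and \<open>q\<close> gives its value.
  The only coordinate left is the one opposite to \<open>{i, j}\<close>, which is determined by the quadric.\<close>
lemma face_charts_lift:
  assumes "(L, B) \<in> set face_charts" "q (face_label L B {}) = 1" "chart_quadric (face_label L B) q"
  shows "\<exists>X\<in>Asym 5. \<forall>S\<in>weights 5. (L ! 0 \<in> S \<longleftrightarrow> L ! 0 \<in> B) \<longrightarrow> wick 5 X S = q S"
proof -
  define u where "u L B S =
    (if B = {} then (if L ! 0 \<in> S then 0 else q S)
     else if L ! 0 \<in> S then q S else if L ! 1 \<in> S then 0 else q (B \<union> S))" for L :: "nat list" and B S
  have "\<forall>(L, B)\<in>set face_charts. q (face_label L B {}) = 1 \<longrightarrow> chart_quadric (face_label L B) q \<longrightarrow>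
     (\<forall>S\<in>weights 5. (L ! 0 \<in> S \<longleftrightarrow> L ! 0 \<in> B) \<longrightarrow> wick 5 (skew_of (u L B)) S = q S)"
    by (simp add: face_charts_def weights_5 chart_quadric_def face_label_def insert_Diff_if insert_commute
          wick_empty wick_pair wick_quadruple u_def skew_of_def del: One_nat_def)
  then have "\<forall>S\<in>weights 5. (L ! 0 \<in> S \<longleftrightarrow> L ! 0 \<in> B) \<longrightarrow> wick 5 (skew_of (u L B)) S = q S"
    using assms by blast
  then show ?thesis using skew_of_Asym by blast
qed

section \<open>Cluster variables as weight coordinates\<close>

lemmas cluster_defs = cluster_X1_def cluster_X3_def cluster_X12_def
  cluster_X23_def cluster_X123_def ducat_N_def exchange_1_def exchange_2_def exchange_3_def

text \<open>If the cluster variables \<open>X\<^sub>1, X\<^sub>1\<^sub>2, X\<^sub>2\<^sub>3, X\<^sub>1\<^sub>2\<^sub>3\<close> are used, up to a common factor, as the matrix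
  entries \<open>x\<^sub>3\<^sub>5, x\<^sub>2\<^sub>3, x\<^sub>2\<^sub>4, x\<^sub>2\<^sub>5\<close>, then the four Pfaffians that belong to initial variables take
  the prescribed values. This makes the coordinate map of the torus surjective.\<close>
lemma cluster_pfaffians:
  assumes "\<forall>v. y v \<noteq> 0"
  shows "y x_3 * y a_8 - y x_1 * cluster_X1 y + y a_2 * y a_3 = - y a_5 * y x_2"
    and "y a_7 * y a_3 - y x_3 * cluster_X23 y + y x_1 * cluster_X12 y = y a_5 * y a_1"
    and "y a_7 * cluster_X1 y - y x_3 * cluster_X123 y + y a_2 * cluster_X12 y = - y a_5 * y a_4"
    and "cluster_X12 y * y a_8 - cluster_X23 y * cluster_X1 y + cluster_X123 y * y a_3 = - y a_5 * y a_6"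
proof -
  have nz: "y x_1 \<noteq> 0" "y x_2 \<noteq> 0" "y x_3 \<noteq> 0" using assms by auto
  show "y x_3 * y a_8 - y x_1 * cluster_X1 y + y a_2 * y a_3 = - y a_5 * y x_2"
    using nz by (simp add: cluster_defs)
  show "y a_7 * y a_3 - y x_3 * cluster_X23 y + y x_1 * cluster_X12 y = y a_5 * y a_1"
    using nz by (simp add: cluster_defs divide_simps)
  show "y a_7 * cluster_X1 y - y x_3 * cluster_X123 y + y a_2 * cluster_X12 y = - y a_5 * y a_4"
    using nz by (simp add: cluster_defs divide_simps) (simp add: algebra_simps power2_eq_square)
  show "cluster_X12 y * y a_8 - cluster_X23 y * cluster_X1 y + cluster_X123 y * y a_3 = - y a_5 * y a_6"
    using nz by (simp add: cluster_defs divide_simps) (simp add: algebra_simps power2_eq_square)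
qed

text \<open>One plus quadric and four minus quadrics. Each of them expresses a non-initial coordinate,
  multiplied by an initial one, by the coordinates that are initial or occur in the relations
  before it.\<close>
lemma spinor_relations:
  assumes "p \<in> spinor_cone 5"
  shows "p {1,4} * p {3,5} = p {1,3} * p {4,5} + p {1,5} * p {3,4} - p {} * p {1,3,4,5}"
    and "p {1,3} * p {1,2,4,5} = p {1,4} * p {1,2,3,5} + p {1,2} * p {1,3,4,5} - p {1,5} * p {1,2,3,4}"
    and "p {1,3,4,5} * p {2,3} = p {3,4} * p {1,2,3,5} + p {1,3} * p {2,3,4,5} - p {3,5} * p {1,2,3,4}"
    and "p {1,3,4,5} * p {2,4} = p {3,4} * p {1,2,4,5} + p {1,4} * p {2,3,4,5} - p {4,5} * p {1,2,3,4}"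
    and "p {1,3,4,5} * p {2,5} = p {3,5} * p {1,2,4,5} + p {1,5} * p {2,3,4,5} - p {4,5} * p {1,2,3,5}"
proof -
  have "\<forall>(L, B)\<in>set face_charts. chart_quadric (face_label L B) p"
    using face_charts_quadric assms by blast
  then show "p {1,4} * p {3,5} = p {1,3} * p {4,5} + p {1,5} * p {3,4} - p {} * p {1,3,4,5}"
    and "p {1,3} * p {1,2,4,5} = p {1,4} * p {1,2,3,5} + p {1,2} * p {1,3,4,5} - p {1,5} * p {1,2,3,4}"
    and "p {1,3,4,5} * p {2,3} = p {3,4} * p {1,2,3,5} + p {1,3} * p {2,3,4,5} - p {3,5} * p {1,2,3,4}"
    and "p {1,3,4,5} * p {2,4} = p {3,4} * p {1,2,4,5} + p {1,4} * p {2,3,4,5} - p {4,5} * p {1,2,3,4}"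
    and "p {1,3,4,5} * p {2,5} = p {3,5} * p {1,2,4,5} + p {1,5} * p {2,3,4,5} - p {4,5} * p {1,2,3,5}"
    by (simp_all add: face_charts_def chart_quadric_def face_label_def insert_Diff_if
          insert_commute algebra_simps del: One_nat_def)
qed

text \<open>The relations on the tenfold have the monomials of the exchange relations, with some signs.
  Changing the signs of the coordinates of \<open>a\<^sub>1\<close> and \<open>a\<^sub>5\<close> makes all signs agree.\<close>
definition ducat_sign :: "ducat_var \<Rightarrow> complex" where
  "ducat_sign v = (if v \<in> {a_1, a_5} then -1 else 1)"

lemma initial_values_coordinates:
  fixes p
  defines "y \<equiv> initial_values ducat_sign p"
  shows "y x_1 = p {1, 4}" "y x_2 = p {1, 3, 4, 5}" "y x_3 = p {1, 3}"
    "y a_1 = - p {1, 2, 3, 4}" "y a_2 = p {1, 5}" "y a_3 = p {3, 4}" "y a_4 = p {1, 2, 3, 5}"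
    "y a_5 = - p {}" "y a_6 = p {2, 3, 4, 5}" "y a_7 = p {1, 2}" "y a_8 = p {4, 5}"
  unfolding y_def initial_values_def ducat_sign_def initial_weight_sets by simp_all

lemma torus_nonzero:
  assumes "p \<in> initial_torus"
  shows "p {1, 4} \<noteq> 0" "p {1, 3, 4, 5} \<noteq> 0" "p {1, 3} \<noteq> 0"
proof -
  have "p (initial_weight v) \<noteq> 0" for v
    using assms by (simp add: initial_torus_def)
  from this[of x_1] this[of x_2] this[of x_3]
  show "p {1, 4} \<noteq> 0" "p {1, 3, 4, 5} \<noteq> 0" "p {1, 3} \<noteq> 0"
    unfolding initial_weight_sets .
qed

text \<open>Five of the seven non-initial cluster variables are the five remaining weight coordinates.
  The other two are the quadratic polynomials \<open>x\<^sub>1 X\<^sub>1\<^sub>2 - a\<^sub>1 a\<^sub>5\<close> and \<open>X\<^sub>1 X\<^sub>3 - a\<^sub>4 a\<^sub>8\<close>,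
  the first of which comes from writing the second exchange polynomial as
  \<open>x\<^sub>1 (a\<^sub>6 x\<^sub>3 + a\<^sub>3 a\<^sub>4) + a\<^sub>1 (a\<^sub>8 x\<^sub>3 + a\<^sub>2 a\<^sub>3)\<close>.\<close>
lemma exchanged_coordinates:
  assumes "p \<in> initial_torus"
  defines "y \<equiv> initial_values ducat_sign p"
  shows "cluster_X1 y = p {3, 5}" "cluster_X3 y = p {1, 2, 4, 5}" "cluster_X12 y = p {2, 3}"
    "cluster_X23 y = p {2, 4}" "cluster_X123 y = p {2, 5}"
    "cluster_X2 y = p {1, 4} * p {2, 3} - p {} * p {1, 2, 3, 4}"
    "cluster_X13 y = p {3, 5} * p {1, 2, 4, 5} - p {4, 5} * p {1, 2, 3, 5}"
proof -
  have cone: "p \<in> spinor_cone 5" using assms(1) by (simp add: initial_torus_def)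
  note rel = spinor_relations[OF cone]
  note nz = torus_nonzero[OF assms(1)]
  note y = initial_values_coordinates[of p, folded y_def]
  show "cluster_X1 y = p {3, 5}"
    unfolding cluster_defs y using nz rel(1) by (simp add: field_simps del: One_nat_def)
  show "cluster_X3 y = p {1, 2, 4, 5}"
    unfolding cluster_defs y using nz rel(2) by (simp add: field_simps del: One_nat_def)
  \<comment> \<open>The numerator is \<open>a\<^sub>1 F\<^sub>1 + x\<^sub>1 (a\<^sub>3 a\<^sub>4 + a\<^sub>6 x\<^sub>3)\<close> with \<open>F\<^sub>1 = x\<^sub>1 X\<^sub>1\<close>.\<close>
  have N12: "p {1, 4} * (p {1, 3, 4, 5} * p {2, 3}) =
     y a_1 * y a_2 * y a_3 + y a_1 * y a_5 * y x_2 + y a_1 * y a_8 * y x_3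
      + y a_3 * y a_4 * y x_1 + y a_6 * y x_1 * y x_3"
    unfolding y using rel(1,3) by algebra
  show "cluster_X12 y = p {2, 3}"
    unfolding cluster_X12_def N12[symmetric] unfolding y using nz by simp
  \<comment> \<open>The numerator is \<open>a\<^sub>3 F\<^sub>3 + x\<^sub>3 (a\<^sub>1 a\<^sub>8 + a\<^sub>6 x\<^sub>1)\<close> with \<open>F\<^sub>3 = x\<^sub>3 X\<^sub>3\<close>.\<close>
  have N23: "p {1, 3} * (p {1, 3, 4, 5} * p {2, 4}) =
     y a_1 * y a_2 * y a_3 + y a_1 * y a_8 * y x_3 + y a_3 * y a_4 * y x_1
      + y a_3 * y a_7 * y x_2 + y a_6 * y x_1 * y x_3"
    unfolding y using rel(2,4) by algebra
  show "cluster_X23 y = p {2, 4}"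
    unfolding cluster_X23_def N23[symmetric] unfolding y using nz by simp
  \<comment> \<open>\<open>N = F\<^sub>1 F\<^sub>3 - a\<^sub>4 a\<^sub>8 x\<^sub>1 x\<^sub>3\<close>\<close>
  have N: "p {1, 4} * p {1, 3} * (p {3, 5} * p {1, 2, 4, 5} - p {4, 5} * p {1, 2, 3, 5}) = ducat_N y"
    unfolding y ducat_N_def using rel(1,2) by algebra
  show "cluster_X13 y = p {3, 5} * p {1, 2, 4, 5} - p {4, 5} * p {1, 2, 3, 5}"
    unfolding cluster_X13_def N[symmetric] unfolding y using nz by simp
  have N': "p {1, 4} * p {1, 3} * (p {1, 3, 4, 5} * p {2, 5}) = ducat_N y + y a_2 * y a_6 * y x_1 * y x_3"
    unfolding y N[symmetric] using rel(5) by algebra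
  show "cluster_X123 y = p {2, 5}"
    unfolding cluster_X123_def N'[symmetric] unfolding y using nz by simp
  have F2: "exchange_2 y = p {1, 3, 4, 5} * (p {1, 4} * p {2, 3} - p {} * p {1, 2, 3, 4})"
    unfolding exchange_2_def y using rel(1,3) by algebra
  show "cluster_X2 y = p {1, 4} * p {2, 3} - p {} * p {1, 2, 3, 4}"
    unfolding cluster_X2_def F2 unfolding y using nz by simp
qed

lemma weight_coordinate_is_cluster_variable:
  assumes "S \<in> weights 5"
  shows "\<exists>Z\<in>cluster_variables. \<exists>\<sigma>\<in>{1, -1}. \<forall>p\<in>initial_torus.
           p S = \<sigma> * Z (initial_values ducat_sign p)"
proof -
  define P where "P S \<longleftrightarrow> (\<exists>Z\<in>cluster_variables. \<exists>\<sigma>\<in>{1, -1}. \<forall>p\<in>initial_torus.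
      p S = \<sigma> * Z (initial_values ducat_sign p))" for S
  have initial: "P (initial_weight v)" for v
    unfolding P_def
    by (rule bexI[of _ "\<lambda>y. y v"], rule bexI[of _ "ducat_sign v"])
       (auto simp: initial_values_def ducat_sign_def cluster_variables_def)
  have exchanged: "P {3, 5}" "P {1, 2, 4, 5}" "P {2, 3}" "P {2, 4}" "P {2, 5}"
    unfolding P_def
    by (rule bexI[of _ cluster_X1] bexI[of _ cluster_X3] bexI[of _ cluster_X12]
          bexI[of _ cluster_X23] bexI[of _ cluster_X123], rule bexI[of _ 1],
        simp add: exchanged_coordinates del: One_nat_def, simp, simp add: cluster_variables_def)+
  have "P S"
    using assms exchanged initial[of x_1] initial[of x_2] initial[of x_3] initial[of a_1]
      initial[of a_2] initial[of a_3] initial[of a_4] initial[of a_5] initial[of a_6]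
      initial[of a_7] initial[of a_8]
    unfolding weights_5 initial_weight_sets by blast
  then show ?thesis by (simp add: P_def)
qed

section \<open>Ducat's algebra on the torus and on the cone\<close>

text \<open>Injectivity holds because every weight coordinate is a function of the initial values. For
  surjectivity, six of the given values and four exchanged variables, all divided by the coordinate
  of the empty weight, are taken as the ten entries of a matrix; its Pfaffians then give the
  remaining initial values.\<close>
lemma initial_values_bij:
  "bij_betw (initial_values ducat_sign) initial_torus {y. \<forall>v. y v \<noteq> 0}"
proof (rule bij_betw_imageI)
  show "inj_on (initial_values ducat_sign) initial_torus"
  proof (rule inj_onI)
    fix p p' assume pp: "p \<in> initial_torus" "p' \<in> initial_torus"
      "initial_values ducat_sign p = initial_values ducat_sign p'"
    show "p = p'"
    proof
      fix S
      show "p S = p' S"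
      proof (cases "S \<in> weights 5")
        case True
        then obtain Z \<sigma> where Z: "\<forall>p\<in>initial_torus. p S = \<sigma> * Z (initial_values ducat_sign p)"
          using weight_coordinate_is_cluster_variable by blast
        show ?thesis using bspec[OF Z pp(1)] bspec[OF Z pp(2)] pp(3) by simp
      next
        case False
        then show ?thesis using pp spinor_cone_supported[of p 5 S] spinor_cone_supported[of p' 5 S]
          by (simp add: initial_torus_def)
      qed
    qed
  qed
next
  have "\<exists>p\<in>initial_torus. initial_values ducat_sign p = y" if y: "\<forall>v. y v \<noteq> 0" for y
  proof -
    \<comment> \<open>the coordinate of the empty weight; the sign comes from the rescaling of \<open>a\<^sub>5\<close>\<close>
    define t where "t = - y a_5"
    have t: "t \<noteq> 0" using y by (simp add: t_def)
    define u where "u = (\<lambda>_. 0)({1, 2} := y a_7 / t, {1, 3} := y x_3 / t, {1, 4} := y x_1 / t,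
      {1, 5} := y a_2 / t, {2, 3} := cluster_X12 y / t, {2, 4} := cluster_X23 y / t,
      {2, 5} := cluster_X123 y / t, {3, 4} := y a_3 / t, {3, 5} := cluster_X1 y / t,
      {4, 5::nat} := y a_8 / t)"
    define p where "p = (\<lambda>S. t * wick 5 (skew_of u) S)"
    have u: "u {1, 2} = y a_7 / t" "u {1, 3} = y x_3 / t" "u {1, 4} = y x_1 / t"
      "u {1, 5} = y a_2 / t" "u {2, 3} = cluster_X12 y / t" "u {2, 4} = cluster_X23 y / t"
      "u {2, 5} = cluster_X123 y / t" "u {3, 4} = y a_3 / t" "u {3, 5} = cluster_X1 y / t"
      "u {4, 5} = y a_8 / t"
      unfolding u_def by (simp_all add: doubleton_eq_iff del: One_nat_def)
    have q: "t * (a * b / (t * t) - c * d / (t * t) + e * f / (t * t)) = z"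
      if "a * b - c * d + e * f = t * z" for a b c d e f z
    proof -
      have "t * (a * b / (t * t) - c * d / (t * t) + e * f / (t * t)) = (a * b - c * d + e * f) / t"
        using t by (simp add: field_simps)
      then show ?thesis using that t by simp
    qed
    note coord = p_def wick_empty wick_pair wick_quadruple skew_of_def u
    have "p {1, 4} = y x_1" "p {1, 3} = y x_3" "p {1, 5} = y a_2" "p {3, 4} = y a_3"
      "p {} = - y a_5" "p {1, 2} = y a_7" "p {4, 5} = y a_8"
      using t by (simp_all add: coord t_def del: One_nat_def)
    moreover have "p {1, 3, 4, 5} = y x_2" "p {1, 2, 3, 4} = - y a_1" "p {1, 2, 3, 5} = y a_4"
      "p {2, 3, 4, 5} = y a_6"
      using cluster_pfaffians[OF y]
      by (simp_all add: coord del: One_nat_def) (rule q; simp add: t_def)+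
    ultimately have eq: "initial_values ducat_sign p v = y v" for v
      by (cases v) (simp_all add: initial_values_coordinates del: One_nat_def)
    have "p \<in> spinor_cone 5"
      unfolding p_def by (rule wick_in_cone[OF skew_of_Asym])
    moreover have "p (initial_weight v) \<noteq> 0" for v
      using eq[of v] y unfolding initial_values_def by force
    ultimately show ?thesis
      using eq by (auto simp: initial_torus_def)
  qed
  moreover have "initial_values ducat_sign p v \<noteq> 0" if "p \<in> initial_torus" for p v
    using that by (simp add: initial_torus_def initial_values_def ducat_sign_def)
  ultimately show "initial_values ducat_sign ` initial_torus = {y. \<forall>v. y v \<noteq> 0}"
    by blast
qed

text \<open>The generators of the two algebras need to agree on \<open>T\<close> only, while they may differ elsewhere.
  So the inclusion holds for the restrictions and not for the algebras themselves.\<close>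
lemma restrict_algebra_subset:
  assumes "\<And>g. g \<in> G \<Longrightarrow> \<exists>h\<in>algebra_generated H. \<forall>p\<in>T. g p = h p"
  shows "(\<lambda>f. restrict f T) ` algebra_generated G \<subseteq> (\<lambda>f. restrict f T) ` algebra_generated H"
proof -
  have "\<exists>h\<in>algebra_generated H. \<forall>p\<in>T. f p = h p" if "f \<in> algebra_generated G" for f
    using that
  proof induction
    case (const z)
    then show ?case by (metis algebra_generated.const)
  next
    case (gen g)
    then show ?case by (rule assms)
  next
    case (add f g)
    then obtain f' g' where "f' \<in> algebra_generated H" "g' \<in> algebra_generated H"
      "\<forall>p\<in>T. f p = f' p" "\<forall>p\<in>T. g p = g' p" by blast
    then show ?case by (intro bexI[of _ "\<lambda>p. f' p + g' p"]) (auto intro: algebra_generated.add)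
  next
    case (mult f g)
    then obtain f' g' where "f' \<in> algebra_generated H" "g' \<in> algebra_generated H"
      "\<forall>p\<in>T. f p = f' p" "\<forall>p\<in>T. g p = g' p" by blast
    then show ?case by (intro bexI[of _ "\<lambda>p. f' p * g' p"]) (auto intro: algebra_generated.mult)
  qed
  then have "\<exists>h\<in>algebra_generated H. restrict f T = restrict h T" if "f \<in> algebra_generated G" for f
    using that by (meson restrict_ext)
  then show ?thesis by blast
qed

lemma initial_weight_in_weights: "initial_weight v \<in> weights 5"
  by (cases v) (simp_all only: initial_weight_sets weights_5 insert_iff simp_thms)

text \<open>Up to sign, the cluster variables are the 16 weight coordinates together with two quadratic
  polynomials in them, so both families generate the same algebra, also after the frozen variables
  are inverted.\<close>
lemma ducat_structure_ducat_sign: "ducat_structure ducat_sign"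
proof -
  let ?v = "initial_values ducat_sign"
  let ?A = "(\<lambda>Z p. Z (?v p)) ` cluster_variables \<union> (\<lambda>v p. inverse (?v p v)) ` frozen"
  let ?B = "(\<lambda>S p. p S) ` weights 5 \<union> (\<lambda>v p. inverse (p (initial_weight v))) ` frozen"
  have sgn: "inverse (?v p v) = ducat_sign v * inverse (p (initial_weight v))" for p v
    by (simp add: initial_values_def ducat_sign_def)
  have sgn': "inverse (p (initial_weight v)) = ducat_sign v * inverse (?v p v)" for p v
    by (simp add: initial_values_def ducat_sign_def)
  have coord: "(\<lambda>p. p S) \<in> algebra_generated ?B" if "S \<in> weights 5" for S
    using that by (auto intro: algebra_generated.gen)
  have quad: "(\<lambda>p. p S * p S' - p U * p U') \<in> algebra_generated ?B"
    if "{S, S', U, U'} \<subseteq> weights 5" for S S' U U'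
  proof -
    have "(\<lambda>p. p S * p S' + - 1 * (p U * p U')) \<in> algebra_generated ?B"
      using that by (intro algebra_generated.add algebra_generated.mult algebra_generated.const coord) auto
    then show ?thesis by simp
  qed
  have A_gens: "\<exists>h\<in>algebra_generated ?B. \<forall>p\<in>initial_torus. g p = h p" if "g \<in> ?A" for g
  proof -
    consider v where "g = (\<lambda>p. ?v p v)" | v where "v \<in> frozen" "g = (\<lambda>p. inverse (?v p v))"
      | Z where "g = (\<lambda>p. Z (?v p))" "Z \<in> {cluster_X1, cluster_X3, cluster_X12, cluster_X23, cluster_X123}"
      | "g = (\<lambda>p. cluster_X2 (?v p))" | "g = (\<lambda>p. cluster_X13 (?v p))"
      using \<open>g \<in> ?A\<close> unfolding cluster_variables_def by auto
    then show ?thesis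
    proof cases
      case (1 v)
      have "(\<lambda>p. ducat_sign v * p (initial_weight v)) \<in> algebra_generated ?B"
        by (intro algebra_generated.mult algebra_generated.const coord initial_weight_in_weights)
      then show ?thesis unfolding 1 by (auto simp: initial_values_def)
    next
      case (2 v)
      have "(\<lambda>p. ducat_sign v * inverse (p (initial_weight v))) \<in> algebra_generated ?B"
        using 2(1) by (intro algebra_generated.mult algebra_generated.const algebra_generated.gen) auto
      then show ?thesis unfolding 2 sgn by auto
    next
      case (3 Z)
      have "{3, 5} \<in> weights 5" "{1, 2, 4, 5} \<in> weights 5" "{2, 3} \<in> weights 5" "{2, 4} \<in> weights 5"
        "{2, 5} \<in> weights 5"
        by (simp_all only: weights_5 insert_iff simp_thms)
      with 3(2) show ?thesis unfolding 3(1)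
        using exchanged_coordinates(1-5) coord by (elim insertE emptyE) (metis (no_types, lifting))+
    next
      case 4
      have "(\<lambda>p. p {1, 4} * p {2, 3} - p {} * p {1, 2, 3, 4}) \<in> algebra_generated ?B"
        by (rule quad) (simp only: weights_5 insert_iff insert_subset empty_subsetI simp_thms)
      then show ?thesis
        unfolding 4 by (rule bexI[rotated]) (intro ballI exchanged_coordinates(6))
    next
      case 5
      have "(\<lambda>p. p {3, 5} * p {1, 2, 4, 5} - p {4, 5} * p {1, 2, 3, 5}) \<in> algebra_generated ?B"
        by (rule quad) (simp only: weights_5 insert_iff insert_subset empty_subsetI simp_thms)
      then show ?thesis
        unfolding 5 by (rule bexI[rotated]) (intro ballI exchanged_coordinates(7))
    qed
  qed
  have B_gens: "\<exists>h\<in>algebra_generated ?A. \<forall>p\<in>initial_torus. g p = h p" if "g \<in> ?B" for g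
    using that
  proof
    assume "g \<in> (\<lambda>S p. p S) ` weights 5"
    then obtain S where S: "S \<in> weights 5" "g = (\<lambda>p. p S)" by blast
    then obtain Z \<sigma> where Z: "Z \<in> cluster_variables" "\<forall>p\<in>initial_torus. p S = \<sigma> * Z (?v p)"
      using weight_coordinate_is_cluster_variable by blast
    have "(\<lambda>p. \<sigma> * Z (?v p)) \<in> algebra_generated ?A"
      using Z(1) by (intro algebra_generated.mult algebra_generated.const algebra_generated.gen) auto
    then show ?thesis unfolding S(2) by (rule bexI[rotated]) (rule Z(2))
  next
    assume "g \<in> (\<lambda>v p. inverse (p (initial_weight v))) ` frozen"
    then obtain v where v: "v \<in> frozen" "g = (\<lambda>p. inverse (p (initial_weight v)))" by blast
    have "(\<lambda>p. ducat_sign v * inverse (?v p v)) \<in> algebra_generated ?A"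
      using v(1) by (intro algebra_generated.mult algebra_generated.const algebra_generated.gen) auto
    then show ?thesis unfolding v(2) sgn' by auto
  qed
  have "(\<lambda>f. restrict f initial_torus) ` algebra_generated ?A =
      (\<lambda>f. restrict f initial_torus) ` algebra_generated ?B"
    by (intro equalityI restrict_algebra_subset A_gens B_gens)
  moreover have "\<forall>v. ducat_sign v \<noteq> 0"
    by (simp add: ducat_sign_def)
  ultimately show ?thesis
    unfolding ducat_structure_def using initial_values_bij by (intro conjI)
qed

section \<open>The web is cluster\<close>

lemma frozen_monomial_inverse:
  assumes "v \<in> frozen"
  shows "frozen_monomial (\<lambda>w. if w = v then - 1 else 0) y = inverse (y v)"
proof -
  have "frozen_monomial (\<lambda>w. if w = v then - 1 else 0) y = (\<Prod>w\<in>frozen. if w = v then inverse (y v) else 1)"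
    unfolding frozen_monomial_def by (intro prod.cong) (auto simp: power_int_minus)
  also have "\<dots> = inverse (y v)"
    using assms by (subst prod.delta) (auto simp: frozen_def)
  finally show ?thesis .
qed

text \<open>The point of the particular charts is that their centre is the weight of a frozen variable:
  dividing by its coordinate only multiplies by a frozen monomial.\<close>
lemma gm_facet_has_chart:
  assumes "F \<in> gm_facets"
  obtains \<beta> v where "wick_chart F \<beta> (\<lambda>_. 1)" "v \<in> frozen" "\<beta> {} = initial_weight v"
proof -
  obtain i s where i: "i \<in> {1..5}" and s: "s \<in> {1/2, - (1/2)}" and F: "F = facet i s"
    using assms by (auto simp: gm_facets_def)
  have "\<forall>i\<in>{1, 2, 3, 4, 5}. \<forall>b. \<exists>(L, B)\<in>set face_charts. L ! 0 = i \<and> (i \<in> B \<longleftrightarrow> b)"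
    by (simp add: face_charts_def del: One_nat_def)
  moreover have "i \<in> {1, 2, 3, 4, 5}" using i by auto
  ultimately obtain L B where LB: "(L, B) \<in> set face_charts"
    and i': "L ! 0 = i" "i \<in> B \<longleftrightarrow> s = - (1/2)" by blast
  have F: "F = {S \<in> weights 5. L ! 0 \<in> S \<longleftrightarrow> L ! 0 \<in> B}"
    using s unfolding F i'(1) i'(2) by (auto simp: facet_def weight_vector_def)
  have "\<forall>(L, B)\<in>set face_charts. distinct L \<and> length L = 5 \<and> set L = {1..5} \<and>
      B \<in> initial_weight ` frozen"
  proof -
    have "{1..5::nat} = {1, 2, 3, 4, 5}" by auto
    then show ?thesis
      by (simp add: face_charts_def frozen_def insert_commute del: One_nat_def)
  qed
  with LB have L: "distinct L" "length L = 5" "set L = {1..5}" and "B \<in> initial_weight ` frozen"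
    by auto
  then obtain v where v: "v \<in> frozen" "B = initial_weight v" by blast
  have "wick_chart F (face_label L B) (\<lambda>_. 1)"
  proof (rule wick_chartI)
    show "bij_betw (face_label L B) (weights 4) F"
      unfolding F using L v(2) initial_weight_in_weights by (intro face_label_bij) auto
    show "chart_quadric (face_label L B) p" if "p \<in> spinor_cone 5" for p
      using face_charts_quadric LB that by blast
    show "\<exists>p\<in>spinor_cone 5. \<forall>S\<in>F. p S = q S"
      if one: "q (face_label L B {}) = 1" and quadric: "chart_quadric (face_label L B) q" for q
    proof -
      obtain X where X: "X \<in> Asym 5"
        "\<forall>S\<in>weights 5. (L ! 0 \<in> S \<longleftrightarrow> L ! 0 \<in> B) \<longrightarrow> wick 5 X S = q S"
        using face_charts_lift[of L B q, OF LB one quadric] by blast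
      then show ?thesis
        using wick_in_cone[OF X(1), of 1] unfolding F by (intro bexI) auto
    qed
  qed
  then show ?thesis
    using that v by (auto simp: face_label_def)
qed

theorem proposition1p2:
  shows "\<exists>c. ducat_structure c \<and>
    (\<forall>F\<in>gm_facets. \<exists>\<beta> \<epsilon>. wick_chart F \<beta> \<epsilon> \<and>
      (\<forall>i\<in>{1..4}. \<forall>j\<in>{1..4}. i < j \<longrightarrow>
        (\<exists>Z\<in>cluster_variables. \<exists>\<sigma>\<in>{1, -1}. \<exists>e. \<forall>p\<in>initial_torus. p (\<beta> {}) \<noteq> 0 \<longrightarrow>
           wick_coordinate \<beta> \<epsilon> i j (face_map F p) =
             \<sigma> * frozen_monomial e (initial_values c p) * Z (initial_values c p))))"
proof (intro exI[of _ ducat_sign] conjI ballI ducat_structure_ducat_sign)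
  fix F assume "F \<in> gm_facets"
  then obtain \<beta> v where chart: "wick_chart F \<beta> (\<lambda>_. 1)" and v: "v \<in> frozen" "\<beta> {} = initial_weight v"
    by (rule gm_facet_has_chart)
  have bij: "bij_betw \<beta> (weights 4) F"
    using chart by (simp add: wick_chart_def)
  have F: "F \<subseteq> weights 5"
    using \<open>F \<in> gm_facets\<close> by (auto simp: gm_facets_def facet_def)
  have "\<exists>Z\<in>cluster_variables. \<exists>\<sigma>\<in>{1, -1}. \<exists>e. \<forall>p\<in>initial_torus. p (\<beta> {}) \<noteq> 0 \<longrightarrow>
           wick_coordinate \<beta> (\<lambda>_. 1) i j (face_map F p) =
             \<sigma> * frozen_monomial e (initial_values ducat_sign p) * Z (initial_values ducat_sign p)"
    if ij: "i \<in> {1..4}" "j \<in> {1..4}" "i < j" for i j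
  proof -
    have mem: "\<beta> {} \<in> F" "\<beta> {i, j} \<in> F"
      using ij by (auto intro!: bij_betw_apply[OF bij] simp: weights_def)
    obtain Z \<sigma> where Z: "Z \<in> cluster_variables" "\<sigma> \<in> {1, -1}"
      "\<forall>p\<in>initial_torus. p (\<beta> {i, j}) = \<sigma> * Z (initial_values ducat_sign p)"
      using weight_coordinate_is_cluster_variable mem F by blast
    have "wick_coordinate \<beta> (\<lambda>_. 1) i j (face_map F p) =
        (ducat_sign v * \<sigma>) * frozen_monomial (\<lambda>w. if w = v then - 1 else 0) (initial_values ducat_sign p)
          * Z (initial_values ducat_sign p)" if "p \<in> initial_torus" for p
      using that mem Z(3) unfolding frozen_monomial_inverse[OF v(1)]
      by (simp add: wick_coordinate_def face_map_def v(2) initial_values_def ducat_sign_def divide_inverse)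
    moreover have "ducat_sign v * \<sigma> \<in> {1, -1}"
      using Z(2) by (auto simp: ducat_sign_def)
    ultimately show ?thesis
      using Z(1) by blast
  qed
  then show "\<exists>\<beta> \<epsilon>. wick_chart F \<beta> \<epsilon> \<and>
      (\<forall>i\<in>{1..4}. \<forall>j\<in>{1..4}. i < j \<longrightarrow>
        (\<exists>Z\<in>cluster_variables. \<exists>\<sigma>\<in>{1, -1}. \<exists>e. \<forall>p\<in>initial_torus. p (\<beta> {}) \<noteq> 0 \<longrightarrow>
           wick_coordinate \<beta> \<epsilon> i j (face_map F p) =
             \<sigma> * frozen_monomial e (initial_values ducat_sign p) * Z (initial_values ducat_sign p)))"
    using chart by blast
qed

end
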